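(* For every $\varepsilon>0$ there exists $n_0(\varepsilon)$ such that, for every integer $n\ge n_0(\varepsilon)$, there are points $p_1,\ldots,p_n\in[0,1]^2$ and real lines $\ell_1,\ldots,\ell_n\subset\mathbb{R}^2$, with $p_i\in\ell_i$ for every $i$, such that $$\operatorname{dist}(p_i,\ell_j)\ge n^{-2/3-\varepsilon}\qquad\text{for all } i\ne j.$$ Equivalently, $\Delta_{\mathrm{PL}}(n)\ge n^{-2/3-\varepsilon}$ for all $n\ge n_0(\varepsilon)$.
   Context: Here $\operatorname{dist}$ is the Euclidean distance from a point to a line in $\mathbb{R}^2$. For an integer $n\ge 2$, $$\Delta_{\mathrm{PL}}(n):=\sup\ \min_{i\ne j}\operatorname{dist}(x_i,\ell_j),$$ where the supremum is over all choices of points $x_1,\ldots,x_n\in[0,1]^2$ and lines $\ell_1,\ldots,\ell_n\subset\mathbb{R}^2$ with $x_i\in\ell_i$ for every $i$. *)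

theory Defs
  imports "HOL-Analysis.Analysis"
begin

definition unit_square :: "(real^2) set" where
  "unit_square = {x. \<forall>k. 0 \<le> x $ k \<and> x $ k \<le> 1}"

definition is_line :: "(real^2) set \<Rightarrow> bool" where
  "is_line L \<longleftrightarrow> affine L \<and> aff_dim L = 1"

definition pl_config :: "nat \<Rightarrow> (nat \<Rightarrow> real^2) \<Rightarrow> (nat \<Rightarrow> (real^2) set) \<Rightarrow> bool" where
  "pl_config n x l \<longleftrightarrow> (\<forall>i\<in>{1..n}. x i \<in> unit_square \<and> is_line (l i) \<and> x i \<in> l i)"

definition pl_min_dist :: "nat \<Rightarrow> (nat \<Rightarrow> real^2) \<Rightarrow> (nat \<Rightarrow> (real^2) set) \<Rightarrow> real" where
  "pl_min_dist n x l =
     Min {infdist (x i) (l j) | i j. i \<in> {1..n} \<and> j \<in> {1..n} \<and> i \<noteq> j}"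

text \<open>Meaningful for \<open>n \<ge> 2\<close> only: otherwise the minimum is over the empty set. For
  \<open>n \<ge> 2\<close> the real supremum is a genuine one, since \<open>x j \<in> l j\<close> bounds every
  distance \<open>infdist (x i) (l j)\<close> by the diameter of the square.\<close>

definition Delta_PL :: "nat \<Rightarrow> real" where
  "Delta_PL n = (SUP (x, l) \<in> {(x, l). pl_config n x l}. pl_min_dist n x l)"

end

theory Submission
  imports Defs
begin

text \<open>
  For \<open>D = 2\<^sup>k\<close> consider points with coordinates \<open>x, y\<close> in the ring \<open>R = \<int>[2\<^bsup>1/D\<^esup>]\<close> of rank \<open>D\<close>, where
  \<open>x\<close> has coefficients of size \<open>L\<close> and \<open>y\<close> coefficients of size \<open>L\<^sup>2\<close>, restricted to the paraboloid on
  which the top coefficient \<open>\<lambda>(y)\<close> equals \<open>\<bar>x\<bar>\<^sup>2\<close>. There are \<open>L\<^bsup>3D-2\<^esup>\<close> of them. Since \<open>\<lambda>(a z)\<close> is a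
  unimodular form on \<open>R\<close>, each point has a slope \<open>a \<in> R\<close> of size \<open>L\<close> tangent to the paraboloid, and by
  convexity \<open>y' - y - a (x' - x)\<close> is a nonzero element of \<open>R\<close> with coefficients of size \<open>L\<^sup>2\<close> for
  distinct points. As its norm is a nonzero integer, its absolute value is at least of order
  \<open>L\<^bsup>-2(D-1)\<^esup>\<close>. Rescaling to the unit square divides by another \<open>L\<^sup>2\<close>, so that \<open>n \<approx> L\<^bsup>3D-2\<^esup>\<close> pairs
  are \<open>L\<^bsup>-2D\<^esup>\<close>-separated; let \<open>D\<close> tend to infinity.
\<close>

section \<open>Arithmetic in the ring generated by \<open>2 powr (1/D)\<close>\<close>

definition rad :: "nat \<Rightarrow> real" where
  "rad D = 2 powr (1 / real D)"

text \<open>Ring elements are carried as coefficient functions, since counting and size bounds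
  concern coefficients; only indices below \<open>D\<close> matter. Linear independence of the
  powers of \<open>rad D\<close> is not presupposed: for \<open>D = 2^k\<close> it comes out of
  \<open>ev_lower_bound\<close>.\<close>

definition ev :: "nat \<Rightarrow> (nat \<Rightarrow> int) \<Rightarrow> real" where
  "ev D w = (\<Sum>i<D. of_int (w i) * rad D ^ i)"

text \<open>Coefficients of the product modulo \<open>t\<^sup>D = 2\<close>.\<close>

definition rmul :: "nat \<Rightarrow> (nat \<Rightarrow> int) \<Rightarrow> (nat \<Rightarrow> int) \<Rightarrow> nat \<Rightarrow> int" where
  "rmul D a b m = (\<Sum>i<D. a i * (if i \<le> m then b (m - i) else 2 * b (m + D - i)))"

lemma rad_power: "D > 0 \<Longrightarrow> rad D ^ D = 2"
  by (simp add: rad_def powr_power)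

lemma rad_double: "rad (2 * D) ^ 2 = rad D"
  by (cases "D = 0") (simp_all add: rad_def powr_power)

lemma rad_ge_1: "1 \<le> rad D"
  by (simp add: rad_def ge_one_powr_ge_zero)

lemma rad_power_le_2: "i \<le> D \<Longrightarrow> rad D ^ i \<le> 2"
  using power_increasing[OF _ rad_ge_1, of i D D] rad_power[of D] by (cases "D = 0") auto

lemma ev_diff: "ev D (\<lambda>i. a i - b i) = ev D a - ev D b"
  by (simp add: ev_def sum_subtractf algebra_simps)

lemma ev_abs_le:
  assumes "\<And>i. i < D \<Longrightarrow> \<bar>w i\<bar> \<le> W"
  shows "\<bar>ev D w\<bar> \<le> 2 * real D * of_int W"
proof -
  have "\<bar>ev D w\<bar> \<le> (\<Sum>i<D. \<bar>of_int (w i) * rad D ^ i\<bar>)"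
    unfolding ev_def by (rule sum_abs)
  also have "\<dots> \<le> (\<Sum>i<D. of_int W * 2)"
  proof (rule sum_mono)
    fix i assume i: "i \<in> {..<D}"
    have "\<bar>of_int (w i)\<bar> \<le> (of_int W :: real)" using assms i by (metis lessThan_iff of_int_abs of_int_le_iff)
    then show "\<bar>of_int (w i) * rad D ^ i\<bar> \<le> of_int W * 2"
      unfolding abs_mult using i rad_ge_1[of D] by (intro mult_mono) (auto simp: rad_power_le_2)
  qed
  finally show ?thesis by simp
qed

text \<open>Multiplying by \<open>rad D ^ i\<close> rotates the coefficients by \<open>i\<close>
  places; those that pass the top re-enter at the bottom with the factor
  \<open>rad D ^ D = 2\<close>.\<close>

lemma ev_shift:
  assumes "i \<le> D"
  shows "ev D (\<lambda>m. if i \<le> m then b (m - i) else 2 * b (m + D - i)) = rad D ^ i * ev D b"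
proof -
  let ?f = "\<lambda>j. of_int (b j) * rad D ^ (i + j)"
  have 1: "(\<Sum>m=i..<D. of_int (b (m - i)) * rad D ^ m) = (\<Sum>j<D-i. ?f j)"
    by (rule sum.reindex_bij_witness[of _ "\<lambda>j. j + i" "\<lambda>m. m - i"]) auto
  have 2: "(\<Sum>m<i. of_int (2 * b (m + D - i)) * rad D ^ m) = (\<Sum>j=D-i..<D. ?f j)"
  proof (rule sum.reindex_bij_witness[of _ "\<lambda>j. j + i - D" "\<lambda>m. m + D - i"])
    fix m assume m: "m \<in> {..<i}"
    then have "rad D ^ (i + (m + D - i)) = rad D ^ D * rad D ^ m"
      using assms by (simp flip: power_add add: add.commute)
    then show "?f (m + D - i) = of_int (2 * b (m + D - i)) * rad D ^ m"
      using rad_power[of D] assms m by simp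
  qed (use assms in auto)
  have "ev D (\<lambda>m. if i \<le> m then b (m - i) else 2 * b (m + D - i))
      = (\<Sum>m<i. of_int (2 * b (m + D - i)) * rad D ^ m)
        + (\<Sum>m=i..<D. of_int (b (m - i)) * rad D ^ m)"
    unfolding ev_def using assms
    by (subst sum.atLeastLessThan_concat[of 0 i D, symmetric, folded lessThan_atLeast0]) 
       (auto intro!: arg_cong2[of _ _ _ _ "(+)"] sum.cong)
  also have "\<dots> = (\<Sum>j<D. ?f j)"
    unfolding 1 2 using sum.atLeastLessThan_concat[of 0 "D-i" D ?f] by (simp add: lessThan_atLeast0)
  finally show ?thesis by (simp add: ev_def sum_distrib_left power_add mult_ac)
qed

lemma ev_rmul: "ev D (rmul D a b) = ev D a * ev D b"
proof -
  have "ev D (rmul D a b)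
      = (\<Sum>i<D. of_int (a i) * ev D (\<lambda>m. if i \<le> m then b (m - i) else 2 * b (m + D - i)))"
    unfolding ev_def rmul_def of_int_sum sum_distrib_right
    by (subst sum.swap) (simp add: sum_distrib_left mult.assoc)
  also have "\<dots> = (\<Sum>i<D. of_int (a i) * rad D ^ i * ev D b)"
    by (intro sum.cong) (auto simp: ev_shift)
  finally show ?thesis by (simp add: sum_distrib_right ev_def)
qed

lemma shift_abs_le:
  fixes b :: "nat \<Rightarrow> int"
  assumes "\<And>i. i < D \<Longrightarrow> \<bar>b i\<bar> \<le> B" "m < D" "i \<le> D"
  shows "\<bar>if i \<le> m then b (m - i) else 2 * b (m + D - i)\<bar> \<le> 2 * B"
proof (cases "i \<le> m")
  case True
  then have "\<bar>b (m - i)\<bar> \<le> B" using assms by simp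
  then show ?thesis using True by simp
next
  case False
  then have "\<bar>b (m + D - i)\<bar> \<le> B" using assms by simp
  then show ?thesis using False by (simp add: abs_mult)
qed

lemma rmul_abs_le:
  assumes "\<And>i. i < D \<Longrightarrow> \<bar>a i\<bar> \<le> A" "\<And>i. i < D \<Longrightarrow> \<bar>b i\<bar> \<le> B" "m < D"
  shows "\<bar>rmul D a b m\<bar> \<le> 2 * int D * A * B"
proof -
  have "\<bar>rmul D a b m\<bar>
      \<le> (\<Sum>i<D. \<bar>a i\<bar> * \<bar>if i \<le> m then b (m - i) else 2 * b (m + D - i)\<bar>)"
    unfolding rmul_def by (rule order_trans[OF sum_abs]) (simp add: abs_mult)
  also have "\<dots> \<le> (\<Sum>i<D. A * (2 * B))"
  proof (rule sum_mono)
    fix i assume i: "i \<in> {..<D}"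
    have "\<bar>if i \<le> m then b (m - i) else 2 * b (m + D - i)\<bar> \<le> 2 * B"
      using assms(2,3) i by (intro shift_abs_le) auto
    then show "\<bar>a i\<bar> * \<bar>if i \<le> m then b (m - i) else 2 * b (m + D - i)\<bar> \<le> A * (2 * B)"
      using assms(1)[of i] i by (intro mult_mono) auto
  qed
  finally show ?thesis by (simp add: mult_ac)
qed

text \<open>No index exceeds \<open>D - 1\<close>, so nothing wraps around and no factor 2 appears.
  Up to reversal the top coefficient is a plain scalar product, which lets a slope realise any
  prescribed integer gradient.\<close>

lemma rmul_top: "rmul D a b (D - 1) = (\<Sum>i<D. a (D - 1 - i) * b i)"
proof -
  have "rmul D a b (D - 1) = (\<Sum>i<D. a i * b (D - 1 - i))"
    unfolding rmul_def by (intro sum.cong) auto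
  also have "\<dots> = (\<Sum>i<D. a (D - 1 - i) * b i)"
    by (rule sum.reindex_bij_witness[of _ "\<lambda>i. D - 1 - i" "\<lambda>i. D - 1 - i"]) auto
  finally show ?thesis .
qed

section \<open>Lower bounds for nonzero ring elements\<close>

text \<open>All wrapped terms are even, so modulo 2 the constant coefficient is multiplicative: it
  is the residue map at the prime above 2.\<close>

lemma odd_rmul_0:
  assumes "D > 0" "odd (a 0)" "odd (b 0)"
  shows "odd (rmul D a b 0)"
proof -
  have "even (\<Sum>i\<in>{..<D} - {0}. a i * (if i \<le> 0 then b (0 - i) else 2 * b (0 + D - i)))"
    by (rule dvd_sum) auto
  moreover have "rmul D a b 0 = a 0 * b 0
      + (\<Sum>i\<in>{..<D} - {0}. a i * (if i \<le> 0 then b (0 - i) else 2 * b (0 + D - i)))"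
    unfolding rmul_def using assms(1) by (subst sum.remove[of _ 0]) auto
  ultimately show ?thesis using assms by simp
qed

text \<open>Even and odd indices give the two coordinates over the subfield of half the degree,
  because \<open>rad (2 * D)\<close> is a square root of \<open>rad D\<close>.\<close>

lemma ev_double:
  "ev (2 * D) w = ev D (\<lambda>i. w (2 * i)) + rad (2 * D) * ev D (\<lambda>i. w (2 * i + 1))"
proof -
  have *: "rad (2 * D) ^ (2 * i) = rad D ^ i" for i
    by (simp only: power_mult rad_double)
  have "(\<Sum>i<2*n. of_int (w i) * rad (2 * D) ^ i) =
     (\<Sum>i<n. of_int (w (2 * i)) * rad D ^ i) + rad (2 * D) * (\<Sum>i<n. of_int (w (2 * i + 1)) * rad D ^ i)" for n
    by (induction n) (simp_all add: * distrib_left mult.left_commute)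
  then show ?thesis by (simp add: ev_def)
qed

text \<open>The exponent is the one given by the norm of \<open>\<rat>(2\<^bsup>1/D\<^esup>)\<close>: the product of \<open>ev D w\<close>
  with its conjugate under \<open>rad D \<mapsto> - rad D\<close> lies in the subfield of half the degree. Its
  constant coefficient stays odd, so it never vanishes.\<close>

lemma ev_lower_bound_odd:
  "\<exists>c>0. \<forall>W\<ge>1. \<forall>w. (\<forall>i<2^k. \<bar>w i\<bar> \<le> W) \<longrightarrow> odd (w 0)
      \<longrightarrow> c / of_int W ^ (2^k - 1) \<le> \<bar>ev (2^k) w\<bar>"
proof (induction k)
  case 0
  \<comment> \<open>In rank 1 the value is the integer \<open>w 0\<close> itself, and the exponent
    of \<open>W\<close> is 0.\<close>
  have "1 \<le> \<bar>ev 1 w\<bar>" if "odd (w 0)" for w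
  proof -
    have "1 \<le> \<bar>w 0\<bar>" using that by (cases "w 0 = 0") auto
    then show ?thesis by (simp add: ev_def)
  qed
  then show ?case by (intro exI[of _ 1]) auto
next
  case (Suc k)
  define D :: nat where "D = 2^k"
  have D: "D > 0" by (simp add: D_def)
  obtain c where c: "c > 0" and
    bound: "\<And>W w. W \<ge> 1 \<Longrightarrow> (\<And>i. i < D \<Longrightarrow> \<bar>w i\<bar> \<le> W) \<Longrightarrow> odd (w 0)
      \<Longrightarrow> c / of_int W ^ (D - 1) \<le> \<bar>ev D w\<bar>"
    using Suc.IH unfolding D_def by blast
  show ?case
  \<comment> \<open>Of the \<open>D\<close> factors \<open>6 * D\<close>, all but one come from the
    coefficient bound for the relative norm \<open>q\<close>, the last from the size of the
    conjugate.\<close>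
  proof (intro exI[of _ "c / (6 * real D) ^ D"] conjI allI impI)
    show "0 < c / (6 * real D) ^ D" using c D by simp
  next
    fix W :: int and w :: "nat \<Rightarrow> int"
    assume W: "1 \<le> W" and w: "\<forall>i<2 ^ Suc k. \<bar>w i\<bar> \<le> W" and odd: "odd (w 0)"
    define u where "u = (\<lambda>i. w (2 * i))"
    define v where "v = (\<lambda>i. w (2 * i + 1))"
    define t where "t = rad (2 * D)"
    have u: "\<bar>u i\<bar> \<le> W" and v: "\<bar>v i\<bar> \<le> W" if "i < D" for i
      using w that by (auto simp: u_def v_def D_def)
    have t: "1 \<le> t" "t \<le> 2" "t * t = rad D"
      using rad_ge_1[of "2 * D"] rad_power_le_2[of 1 "2 * D"] D rad_double[of D]
      by (auto simp: t_def power2_eq_square)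
    define vv where "vv = rmul D v v"
    \<comment> \<open>These are the coefficients of \<open>u^2 - rad D * v^2\<close>; the shift by
      one place is the multiplication by \<open>rad D\<close>. In the constant coefficient the
      shifted part is even, so its parity is that of \<open>w 0\<close>.\<close>
    define q where "q = (\<lambda>m. rmul D u u m - (if 1 \<le> m then vv (m - 1) else 2 * vv (m + D - 1)))"
    have evq: "ev D q = (ev D u + t * ev D v) * (ev D u - t * ev D v)"
      unfolding q_def ev_diff ev_shift[of 1, OF Suc_leI[OF D, folded One_nat_def]] vv_def ev_rmul
      by (simp add: t(3)[symmetric] algebra_simps)
    have oddq: "odd (q 0)"
      using odd_rmul_0[OF D, of u u] odd by (simp add: q_def u_def)
    have vv: "\<bar>vv m\<bar> \<le> 2 * int D * W * W" if "m < D" for m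
      unfolding vv_def by (rule rmul_abs_le[OF v v that])
    have q: "\<bar>q m\<bar> \<le> 6 * int D * W * W" if "m < D" for m
    proof -
      have "\<bar>rmul D u u m\<bar> \<le> 2 * int D * W * W" by (rule rmul_abs_le[OF u u that])
      moreover have "\<bar>if 1 \<le> m then vv (m - 1) else 2 * vv (m + D - 1)\<bar> \<le> 2 * (2 * int D * W * W)"
        by (rule shift_abs_le[OF vv that]) (use D in auto)
      ultimately show ?thesis unfolding q_def by linarith
    qed
    have "1 * 1 * 1 \<le> 6 * int D * W * W" using D W by (intro mult_mono) auto
    then have "c / of_int (6 * int D * W * W) ^ (D - 1) \<le> \<bar>ev D q\<bar>"
      by (intro bound q oddq) auto
    also have "\<dots> \<le> \<bar>ev D u + t * ev D v\<bar> * (6 * real D * of_int W)"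
    proof -
      have "\<bar>ev D u - t * ev D v\<bar> \<le> \<bar>ev D u\<bar> + t * \<bar>ev D v\<bar>"
        using abs_triangle_ineq4[of "ev D u" "t * ev D v"] t by (simp add: abs_mult)
      also have "t * \<bar>ev D v\<bar> \<le> 2 * (2 * real D * of_int W)"
        using ev_abs_le[of D v W, OF v] t by (intro mult_mono) auto
      also have "\<bar>ev D u\<bar> \<le> 2 * real D * of_int W" using ev_abs_le[of D u W, OF u] by simp
      finally have "\<bar>ev D u - t * ev D v\<bar> \<le> 6 * real D * of_int W" by (simp add: mult_ac)
      then show ?thesis unfolding evq abs_mult by (rule mult_left_mono) simp
    qed
    finally have "c / of_int (6 * int D * W * W) ^ (D - 1) / (6 * real D * of_int W)
        \<le> \<bar>ev D u + t * ev D v\<bar>"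
      using D W by (subst pos_divide_le_eq) auto
    also have "ev D u + t * ev D v = ev (2 ^ Suc k) w"
      using ev_double[of D w] by (simp add: u_def v_def t_def D_def)
    \<comment> \<open>The powers of \<open>W\<close> add up to \<open>2 * (D - 1)\<close> from
      \<open>q\<close> and one from the conjugate, which is \<open>2 ^ Suc k - 1\<close>.\<close>
    also have "c / of_int (6 * int D * W * W) ^ (D - 1) / (6 * real D * of_int W)
        = c / (6 * real D) ^ D / of_int W ^ (2 ^ Suc k - 1)"
    proof -
      obtain d where "D = Suc d" using D by (cases D) auto
      moreover have "(2::nat) ^ Suc k - 1 = Suc (2 * d)" using calculation by (simp add: D_def)
      ultimately show ?thesis by (simp add: power_mult_distrib power_mult power2_eq_square mult_ac)
    qed
    finally show "c / (6 * real D) ^ D / of_int W ^ (2 ^ Suc k - 1) \<le> \<bar>ev (2 ^ Suc k) w\<bar>" .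
  qed
qed

text \<open>While the constant coefficient is even, the element can be divided by
  \<open>rad D\<close>. This moves the odd coefficient one place down, keeps the bound
  \<open>W\<close>, and does not increase the absolute value since \<open>rad D\<close> is at least
  1.\<close>

lemma ev_lower_bound_some_odd:
  assumes bound: "\<And>w. (\<And>i. i < D \<Longrightarrow> \<bar>w i\<bar> \<le> W) \<Longrightarrow> odd (w 0) \<Longrightarrow> \<beta> \<le> \<bar>ev D w\<bar>"
  assumes "\<And>i. i < D \<Longrightarrow> \<bar>w i\<bar> \<le> W" "j < D" "odd (w j)"
  shows "\<beta> \<le> \<bar>ev D w\<bar>"
  using assms(2-)
proof (induction j arbitrary: w)
  case 0
  then show ?case using bound by blast
next
  case (Suc j)
  show ?case
  proof (cases "odd (w 0)")
    case True
    then show ?thesis using bound Suc.prems by blast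
  next
    case False
    \<comment> \<open>The quotient by \<open>rad D\<close>: the constant \<open>w 0\<close> equals
      \<open>(w 0 div 2) * rad D ^ D\<close>, so its half lands in the top place.\<close>
    define u where "u = (\<lambda>m. if m = D - 1 then w 0 div 2 else w (Suc m))"
    have "ev D w = ev D (\<lambda>m. if 1 \<le> m then u (m - 1) else 2 * u (m + D - 1))"
    proof -
      have "w m = (if 1 \<le> m then u (m - 1) else 2 * u (m + D - 1))" if "m < D" for m
        using that False Suc.prems(2) by (cases m) (auto simp: u_def)
      then show ?thesis unfolding ev_def by (intro sum.cong) auto
    qed
    also have "\<dots> = rad D * ev D u"
      using ev_shift[of 1 D u] Suc.prems by simp
    finally have *: "\<bar>ev D w\<bar> = rad D * \<bar>ev D u\<bar>" using rad_ge_1[of D] by (simp add: abs_mult)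
    have "\<bar>u i\<bar> \<le> W" if "i < D" for i
      using Suc.prems(1)[of 0] Suc.prems(1)[of "Suc i"] that by (auto simp: u_def)
    moreover have "odd (u j)" using Suc.prems by (auto simp: u_def)
    ultimately have "\<beta> \<le> \<bar>ev D u\<bar>" using Suc by auto
    also have "\<dots> \<le> \<bar>ev D w\<bar>" unfolding * using mult_right_mono[OF rad_ge_1[of D], of "\<bar>ev D u\<bar>"] by simp
    finally show ?thesis .
  qed
qed

text \<open>If all coefficients are even, halving them keeps the bound \<open>W\<close> and only
  decreases the value; the descent on the size of \<open>w j\<close> stops at an odd
  coefficient.\<close>

lemma ev_lower_bound_nonzero:
  assumes bound: "\<And>w. (\<And>i. i < D \<Longrightarrow> \<bar>w i\<bar> \<le> W) \<Longrightarrow> odd (w 0) \<Longrightarrow> \<beta> \<le> \<bar>ev D w\<bar>"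
  assumes "\<And>i. i < D \<Longrightarrow> \<bar>w i\<bar> \<le> W" "j < D" "w j \<noteq> 0"
  shows "\<beta> \<le> \<bar>ev D w\<bar>"
  using assms(2-)
proof (induction "nat \<bar>w j\<bar>" arbitrary: w rule: less_induct)
  case less
  show ?case
  proof (cases "\<exists>i<D. odd (w i)")
    case True
    then show ?thesis using ev_lower_bound_some_odd[OF bound, where W = W] less.prems by blast
  next
    case False
    define u where "u = (\<lambda>i. w i div 2)"
    have wu: "w i = 2 * u i" if "i < D" for i using False that by (auto simp: u_def)
    have "ev D w = 2 * ev D u" by (simp add: ev_def wu sum_distrib_left mult_ac)
    moreover have "\<beta> \<le> \<bar>ev D u\<bar>"
    proof (rule less.hyps)
      show "nat \<bar>u j\<bar> < nat \<bar>w j\<bar>" "u j \<noteq> 0" using less.prems wu[of j] by auto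
      show "\<bar>u i\<bar> \<le> W" if "i < D" for i using less.prems(1)[OF that] wu[OF that] by auto
    qed (use less.prems in auto)
    ultimately show ?thesis by (simp add: abs_mult)
  qed
qed

lemma ev_lower_bound:
  obtains c where "c > 0"
    "\<And>W w j. \<lbrakk>W \<ge> 1; \<And>i. i < 2^k \<Longrightarrow> \<bar>w i\<bar> \<le> W; j < 2^k; w j \<noteq> 0\<rbrakk>
      \<Longrightarrow> c / of_int W ^ (2^k - 1) \<le> \<bar>ev (2^k) w\<bar>"
proof -
  obtain c where c: "c > 0" "\<And>W w. \<lbrakk>W \<ge> 1; \<And>i. i < 2^k \<Longrightarrow> \<bar>w i\<bar> \<le> W; odd (w 0)\<rbrakk>
      \<Longrightarrow> c / of_int W ^ (2^k - 1) \<le> \<bar>ev (2^k) w\<bar>"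
    using ev_lower_bound_odd[of k] by blast
  show thesis
    by (rule that[OF c(1)], rule ev_lower_bound_nonzero[OF c(2)]) auto
qed

section \<open>Lines of prescribed slope\<close>

definition slope_line :: "real^2 \<Rightarrow> real \<Rightarrow> (real^2) set" where
  "slope_line p a = affine hull {p, p + vector [1, a]}"

lemma is_line_slope_line: "is_line (slope_line p a)"
proof -
  have "(vector [1, a] :: real^2) \<noteq> 0" by (metis vector_2(1) zero_index zero_neq_one)
  then show ?thesis by (simp add: is_line_def slope_line_def aff_dim_affine_hull aff_dim_2)
qed

lemma mem_slope_line: "p \<in> slope_line p a"
  by (simp add: slope_line_def hull_inc)

lemma slope_line_eq:
  assumes "z \<in> slope_line p a"
  shows "z $ 2 - p $ 2 = a * (z $ 1 - p $ 1)"
proof -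
  obtain u v where "z = u *\<^sub>R p + v *\<^sub>R (p + vector [1, a])" "u + v = 1"
    using assms unfolding slope_line_def affine_hull_2 by blast
  moreover from this have "u = 1 - v" by simp
  ultimately show ?thesis by (simp add: algebra_simps)
qed

text \<open>The functional \<open>z $ 2 - a * z $ 1\<close> is constant on the line and Lipschitz
  with constant \<open>1 + \<bar>a\<bar>\<close>, so vertical separation bounds the distance from
  below.\<close>

lemma infdist_slope_line_ge:
  "\<bar>q $ 2 - p $ 2 - a * (q $ 1 - p $ 1)\<bar> / (1 + \<bar>a\<bar>) \<le> infdist q (slope_line p a)"
proof -
  have "\<bar>q $ 2 - p $ 2 - a * (q $ 1 - p $ 1)\<bar> / (1 + \<bar>a\<bar>) \<le> dist q z" if "z \<in> slope_line p a" for z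
  proof -
    have "q $ 2 - p $ 2 - a * (q $ 1 - p $ 1) = (q - z) $ 2 - a * (q - z) $ 1"
      using slope_line_eq[OF that] by (simp add: algebra_simps)
    also have "\<bar>\<dots>\<bar> \<le> \<bar>(q - z) $ 2\<bar> + \<bar>a\<bar> * \<bar>(q - z) $ 1\<bar>"
      using abs_triangle_ineq4[of "(q - z) $ 2" "a * (q - z) $ 1"] by (simp only: abs_mult)
    also have "\<dots> \<le> dist q z + \<bar>a\<bar> * dist q z"
      unfolding dist_norm by (intro add_mono mult_left_mono component_le_norm_cart) auto
    finally show ?thesis by (subst pos_divide_le_eq) (auto simp: algebra_simps)
  qed
  moreover have "slope_line p a \<noteq> {}" using mem_slope_line by blast
  ultimately show ?thesis by (simp add: infdist_notempty cINF_greatest)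
qed

section \<open>From separated configurations to \<open>Delta_PL\<close>\<close>

lemma dist_unit_square_le:
  assumes "x \<in> unit_square" "y \<in> unit_square"
  shows "dist x y \<le> 2"
proof -
  have "norm (x - y) \<le> (\<Sum>k\<in>UNIV. \<bar>(x - y) $ k\<bar>)" by (rule norm_le_l1_cart)
  also have "\<dots> \<le> (\<Sum>k\<in>(UNIV :: 2 set). 1)"
  proof (rule sum_mono)
    fix k :: 2
    have "0 \<le> x $ k" "x $ k \<le> 1" "0 \<le> y $ k" "y $ k \<le> 1"
      using assms by (auto simp: unit_square_def)
    then show "\<bar>(x - y) $ k\<bar> \<le> 1" by simp
  qed
  finally show ?thesis by (simp add: dist_norm)
qed

lemma Delta_PL_ge:
  assumes "n \<ge> 2" "pl_config n p l"
    and sep: "\<And>i j. i \<in> {1..n} \<Longrightarrow> j \<in> {1..n} \<Longrightarrow> i \<noteq> j \<Longrightarrow> e \<le> infdist (p i) (l j)"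
  shows "e \<le> Delta_PL n"
proof -
  define dists where "dists = (\<lambda>(x :: nat \<Rightarrow> real^2) (l :: nat \<Rightarrow> (real^2) set).
    {infdist (x i) (l j) | i j. i \<in> {1..n} \<and> j \<in> {1..n} \<and> i \<noteq> j})"
  have min: "pl_min_dist n x l = Min (dists x l)" for x l
    by (simp add: pl_min_dist_def dists_def)
  have fin: "finite (dists x l)" for x l
    by (rule finite_subset[of _ "(\<lambda>(i, j). infdist (x i) (l j)) ` ({1..n} \<times> {1..n})"])
       (auto simp: dists_def)
  have one_two: "infdist (x 1) (l 2) \<in> dists x l" for x l
    using assms(1) unfolding dists_def by (intro CollectI exI[of _ 1] exI[of _ 2]) auto
  have "e \<le> pl_min_dist n p l"
    unfolding min
  proof (rule Min.boundedI)
    show "dists p l \<noteq> {}" using one_two by blast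
  qed (use fin sep in \<open>auto simp: dists_def\<close>)
  also have "\<dots> \<le> Delta_PL n"
    unfolding Delta_PL_def
  proof (rule cSUP_upper2[where x = "(p, l)"])
    \<comment> \<open>A real supremum dominates its members only if the set is bounded above. The
      pair (1, 2) suffices, as \<open>x 2\<close> lies on \<open>l 2\<close>.\<close>
    show "bdd_above ((\<lambda>(x, l). pl_min_dist n x l) ` {(x, l). pl_config n x l})"
    proof (rule bdd_aboveI2, safe)
      fix x l assume c: "pl_config n x l"
      have "pl_min_dist n x l \<le> infdist (x 1) (l 2)"
        unfolding min using fin one_two by (rule Min_le)
      also have "\<dots> \<le> dist (x 1) (x 2)"
        using c assms(1) by (intro infdist_le) (auto simp: pl_config_def)
      also have "\<dots> \<le> 2"
        using c assms(1) by (intro dist_unit_square_le) (auto simp: pl_config_def)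
      finally show "pl_min_dist n x l \<le> 2" .
    qed
  qed (use assms in auto)
  finally show ?thesis .
qed


section \<open>The paraboloid construction\<close>

lemma ex_inj_into_finite:
  assumes "finite F" "n \<le> card F"
  obtains f where "inj_on f {1..n::nat}" "\<And>i. i \<in> {1..n} \<Longrightarrow> f i \<in> F"
proof -
  obtain f where "f ` {1..n} \<subseteq> F" "inj_on f {1..n}"
    using card_le_inj[of "{1..n}" F] assms by auto
  then show thesis by (intro that[of f]) auto
qed

text \<open>The slope is \<open>2 \<cdot> x\<close> with reversed coefficients, since reversal turns the form
  \<open>(a, z) \<mapsto> \<lambda>(a z)\<close> into the scalar product (\<open>rmul_top\<close>).\<close>

lemma separated_config:
  fixes k :: nat
  defines "D \<equiv> 2^k"
  shows "\<exists>c>0. \<forall>L\<ge>1. \<forall>n \<le> L ^ (D + 2 * (D - 1)). \<exists>p l. pl_config n p l \<and>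
    (\<forall>i\<in>{1..n}. \<forall>j\<in>{1..n}. i \<noteq> j \<longrightarrow> c / real L ^ (2 * D) \<le> infdist (p i) (l j))"
proof -
  have D: "D \<ge> 1" by (simp add: D_def)
  obtain c0 where c0: "c0 > 0" and lower:
    "\<And>W w j. \<lbrakk>W \<ge> 1; \<And>i. i < D \<Longrightarrow> \<bar>w i\<bar> \<le> W; j < D; w j \<noteq> 0\<rbrakk>
      \<Longrightarrow> c0 / of_int W ^ (D - 1) \<le> \<bar>ev D w\<bar>"
    using ev_lower_bound[of k] unfolding D_def by blast
  \<comment> \<open>\<open>5 * D\<close> comes from the coefficient bound for \<open>w\<close>;
    \<open>10 * D^2\<close> is the vertical scale \<open>2 * D^2\<close> times the bound 5 on
    \<open>1 + \<bar>s j\<bar>\<close>.\<close>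
  define c where "c = c0 / (5 * real D) ^ (D - 1) / (10 * real D ^ 2)"
  show ?thesis
  proof (intro exI[of _ c] conjI allI impI)
    show "0 < c" using c0 D by (simp add: c_def)
  next
    fix L n :: nat
    assume L: "1 \<le> L" and n: "n \<le> L ^ (D + 2 * (D - 1))"
    \<comment> \<open>Only \<open>D - 1\<close> coefficients of \<open>y\<close> are free, as the
      top one is fixed by \<open>x\<close>.\<close>
    define F where "F = ({..<D} \<rightarrow>\<^sub>E {0..<int L}) \<times> ({..<D - 1} \<rightarrow>\<^sub>E {0..<(int L)\<^sup>2})"
    have "finite F" unfolding F_def by (intro finite_cartesian_product finite_PiE) auto
    moreover have "card F = L ^ (D + 2 * (D - 1))"
      by (simp add: F_def card_cartesian_product card_PiE power_add power_mult nat_power_eq)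
    ultimately obtain f where inj: "inj_on f {1..n}" and f: "\<And>i. i \<in> {1..n} \<Longrightarrow> f i \<in> F"
      using n ex_inj_into_finite[of F n] by metis
    define x where "x = (\<lambda>i. fst (f i))"
    define y where "y = (\<lambda>i m. if m = D - 1 then (\<Sum>h<D. (x i h)\<^sup>2) else snd (f i) m)"
    define a where "a = (\<lambda>i m. 2 * x i (D - 1 - m))"
    have x: "0 \<le> x i m" "x i m \<le> int L" if "i \<in> {1..n}" "m < D" for i m
      using f[OF that(1)] that(2) by (force simp: F_def x_def PiE_iff)+
    have y: "0 \<le> y i m \<and> y i m \<le> int D * (int L)\<^sup>2" if "i \<in> {1..n}" "m < D" for i m
    proof (cases "m = D - 1")
      case True
      have "(\<Sum>h<D. (x i h)\<^sup>2) \<le> (\<Sum>h<D. (int L)\<^sup>2)"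
        using x[OF that(1)] by (intro sum_mono power_mono) auto
      then show ?thesis using True by (simp add: y_def sum_nonneg)
    next
      case False
      then have "snd (f i) m \<in> {0..<(int L)\<^sup>2}"
        using f[OF that(1)] that(2) by (auto simp: F_def PiE_iff)
      moreover have "1 * (int L)\<^sup>2 \<le> int D * (int L)\<^sup>2" using D by (intro mult_right_mono) auto
      ultimately show ?thesis using False by (simp add: y_def)
    qed
    have a: "\<bar>a i m\<bar> \<le> 2 * int L" if "i \<in> {1..n}" "m < D" for i m
      using x[OF that(1), of "D - 1 - m"] that by (simp add: a_def)
    \<comment> \<open>The scales are the bounds of \<open>ev_abs_le\<close> for coefficients up to
      \<open>L\<close> and \<open>D * L^2\<close>. Their quotient \<open>D * L\<close> rescales the
      slope below.\<close>
    define p where "p = (\<lambda>i. vector [ev D (x i) / (2 * real D * L),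
        ev D (y i) / (2 * (real D)\<^sup>2 * (real L)\<^sup>2)] :: real^2)"
    define s where "s = (\<lambda>i. ev D (a i) / (real D * L))"
    have DL: "real D > 0" "real L > 0" using D L by auto
    show "\<exists>p l. pl_config n p l \<and>
      (\<forall>i\<in>{1..n}. \<forall>j\<in>{1..n}. i \<noteq> j \<longrightarrow> c / real L ^ (2 * D) \<le> infdist (p i) (l j))"
    proof (intro exI[of _ p] exI[of _ "\<lambda>i. slope_line (p i) (s i)"] conjI ballI impI)
      have "p i \<in> unit_square" if i: "i \<in> {1..n}" for i
      proof -
        have "0 \<le> ev D (x i)" "0 \<le> ev D (y i)"
          unfolding ev_def using x[OF i] y[OF i] rad_ge_1[of D]
          by (auto intro!: sum_nonneg mult_nonneg_nonneg zero_le_power)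
        moreover have "\<bar>ev D (x i)\<bar> \<le> 2 * real D * of_int (int L)"
          using x[OF i] by (intro ev_abs_le) auto
        moreover have "\<bar>ev D (y i)\<bar> \<le> 2 * real D * of_int (int D * (int L)\<^sup>2)"
          using y[OF i] by (intro ev_abs_le) auto
        ultimately show ?thesis
          using DL by (auto simp: unit_square_def p_def forall_2 divide_le_eq_1 power2_eq_square mult_ac)
      qed
      then show "pl_config n p (\<lambda>i. slope_line (p i) (s i))"
        by (simp add: pl_config_def is_line_slope_line mem_slope_line)
    next
      fix i j assume i: "i \<in> {1..n}" and j: "j \<in> {1..n}" and "i \<noteq> j"
      define z where "z = (\<lambda>m. x i m - x j m)"
      define w where "w = (\<lambda>m. (y i m - y j m) - rmul D (a j) z m)"
      have z: "\<bar>z m\<bar> \<le> int L" if "m < D" for m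
        using x[OF i that] x[OF j that] by (simp add: z_def)
      \<comment> \<open>One unit of \<open>D * L^2\<close> comes from the difference of the
        \<open>y\<close>, whose coefficients are nonnegative, and four from the product with the
        slope.\<close>
      have w: "\<bar>w m\<bar> \<le> 5 * int D * (int L)\<^sup>2" if "m < D" for m
      proof -
        have "\<bar>rmul D (a j) z m\<bar> \<le> 2 * int D * (2 * int L) * int L"
          using a[OF j] z that by (intro rmul_abs_le) auto
        also have "\<dots> = 4 * (int D * (int L)\<^sup>2)" by (simp add: power2_eq_square)
        finally have "\<bar>w m\<bar> \<le> 5 * (int D * (int L)\<^sup>2)"
          using y[OF i that] y[OF j that] unfolding w_def by linarith
        then show ?thesis by (simp only: mult.assoc)
      qed
      have "\<exists>m<D. w m \<noteq> 0"
      proof (cases "\<exists>m<D. z m \<noteq> 0")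
        case True
        have "w (D - 1) = (\<Sum>h<D. (x i h)\<^sup>2) - (\<Sum>h<D. (x j h)\<^sup>2) - (\<Sum>h<D. 2 * x j h * z h)"
          unfolding w_def rmul_top by (simp add: y_def a_def)
        \<comment> \<open>Strict convexity: a quadratic form minus its tangent at \<open>x j\<close>
          is the form of the difference.\<close>
        also have "\<dots> = (\<Sum>h<D. (z h)\<^sup>2)"
          by (simp add: z_def power2_eq_square algebra_simps flip: sum_subtractf)
        also have "\<dots> > 0"
          using True by (auto intro!: sum_pos2)
        finally show ?thesis using D by (intro exI[of _ "D - 1"]) auto
      next
        case False
        \<comment> \<open>With equal \<open>x\<close> the product with the slope vanishes, and
          injectivity of \<open>f\<close> forces a difference in a free coefficient of
          \<open>y\<close>.\<close>
        have fi: "f i \<in> F" and fj: "f j \<in> F" using f i j by auto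
        have "fst (f i) = fst (f j)"
          using False fi fj by (intro PiE_ext[of _ "{..<D}" "\<lambda>_. {0..<int L}"]) (auto simp: F_def z_def x_def)
        moreover have "f i \<noteq> f j" using inj i j \<open>i \<noteq> j\<close> by (auto dest: inj_onD)
        ultimately have "snd (f i) \<noteq> snd (f j)" by (auto simp: prod_eq_iff)
        moreover have "snd (f i) \<in> {..<D - 1} \<rightarrow>\<^sub>E {0..<(int L)\<^sup>2}" "snd (f j) \<in> {..<D - 1} \<rightarrow>\<^sub>E {0..<(int L)\<^sup>2}"
          using fi fj by (auto simp: F_def)
        ultimately obtain m where m: "m < D - 1" "snd (f i) m \<noteq> snd (f j) m"
          by (metis PiE_ext lessThan_iff)
        moreover have "rmul D (a j) z m = 0"
          unfolding rmul_def using False m by (intro sum.neutral) auto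
        ultimately show ?thesis by (intro exI[of _ m]) (auto simp: w_def y_def)
      qed
      then obtain m where m: "m < D" "w m \<noteq> 0" by blast
      have "1 * 1 * 1\<^sup>2 \<le> 5 * int D * (int L)\<^sup>2" using D L by (intro mult_mono power_mono) auto
      then have evw: "c0 / of_int (5 * int D * (int L)\<^sup>2) ^ (D - 1) \<le> \<bar>ev D w\<bar>"
        by (intro lower[where w = w and j = m] w m) auto
      have vertical: "\<bar>p i $ 2 - p j $ 2 - s j * (p i $ 1 - p j $ 1)\<bar>
          = \<bar>ev D w\<bar> / (2 * (real D)\<^sup>2 * (real L)\<^sup>2)"
      proof -
        have "ev D w = ev D (y i) - ev D (y j) - ev D (a j) * (ev D (x i) - ev D (x j))"
          by (simp add: w_def z_def ev_diff ev_rmul)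
        then have "p i $ 2 - p j $ 2 - s j * (p i $ 1 - p j $ 1) = ev D w / (2 * (real D)\<^sup>2 * (real L)\<^sup>2)"
          using DL by (simp only:) (simp add: p_def s_def field_simps power2_eq_square)
        then show ?thesis by (simp add: abs_mult)
      qed
      have slope: "1 + \<bar>s j\<bar> \<le> 5"
      proof -
        have "\<bar>ev D (a j)\<bar> \<le> 2 * real D * of_int (2 * int L)"
          using a[OF j] by (intro ev_abs_le) auto
        then show ?thesis using DL by (simp add: s_def abs_mult field_simps)
      qed
      have "c0 / of_int (5 * int D * (int L)\<^sup>2) ^ (D - 1) / (2 * (real D)\<^sup>2 * (real L)\<^sup>2) / 5
          \<le> \<bar>p i $ 2 - p j $ 2 - s j * (p i $ 1 - p j $ 1)\<bar> / (1 + \<bar>s j\<bar>)"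
        unfolding vertical by (intro frac_le divide_right_mono evw slope) auto
      also have "\<dots> \<le> infdist (p i) (slope_line (p j) (s j))"
        by (rule infdist_slope_line_ge)
      also have "c0 / of_int (5 * int D * (int L)\<^sup>2) ^ (D - 1) / (2 * (real D)\<^sup>2 * (real L)\<^sup>2) / 5
          = c / real L ^ (2 * D)"
      proof -
        obtain d where "D = Suc d" using D by (cases D) auto
        then show ?thesis
          by (simp add: c_def power_mult_distrib power_mult power_add power2_eq_square mult_ac)
      qed
      finally show "c / real L ^ (2 * D) \<le> infdist (p i) (slope_line (p j) (s j))" .
    qed
  qed
qed

section \<open>Choice of parameters\<close>

text \<open>Rounding the \<open>m\<close>-th root of \<open>n\<close> up to an integer at most
  doubles it once \<open>n\<close> is positive, so every \<open>n\<close> is covered at the cost of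
  a constant.\<close>

lemma ex_power_ge:
  assumes "m > 0"
  shows "\<exists>L\<ge>1. n \<le> L ^ m \<and> (n \<ge> 1 \<longrightarrow> real L \<le> 2 * real n powr (1 / real m))"
proof (intro exI conjI impI)
  define r where "r = real n powr (1 / real m)"
  define L where "L = max 1 (nat \<lceil>r\<rceil>)"
  show "L \<ge> 1" by (simp add: L_def)
  have "r \<le> real L" unfolding L_def by linarith
  then have "r ^ m \<le> real L ^ m" by (intro power_mono) (auto simp: r_def)
  moreover have "r ^ m = real n" using assms by (cases "n = 0") (auto simp: r_def powr_power)
  ultimately show "n \<le> L ^ m" by (simp flip: of_nat_power)
  assume "n \<ge> 1"
  then have "r \<ge> 1" by (simp add: r_def ge_one_powr_ge_zero)
  then show "real L \<le> 2 * real n powr (1 / real m)" unfolding L_def r_def[symmetric] by linarith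
qed

theorem theorem1p1:
  fixes \<epsilon> :: real
  assumes "\<epsilon> > 0"
  shows "\<exists>n0::nat. n0 \<ge> 2 \<and> (\<forall>n\<ge>n0.
           (\<exists>(p :: nat \<Rightarrow> real^2) (l :: nat \<Rightarrow> (real^2) set).
              pl_config n p l \<and>
              (\<forall>i\<in>{1..n}. \<forall>j\<in>{1..n}. i \<noteq> j \<longrightarrow>
                 infdist (p i) (l j) \<ge> real n powr (- 2 / 3 - \<epsilon>))) \<and>
           Delta_PL n \<ge> real n powr (- 2 / 3 - \<epsilon>))"
proof -
  \<comment> \<open>The construction has exponent
    \<open>2*D / (3*D - 2) = 2/3 + 4 / (3 * (3*D - 2))\<close>. Since \<open>3*D - 2\<close> is at
    least \<open>D\<close>, the condition \<open>D > 2 / \<epsilon>\<close> makes the excess smaller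
    than \<open>\<epsilon>\<close>.\<close>
  obtain k where "2 / \<epsilon> < 2 ^ k" using real_arch_pow[of 2 "2 / \<epsilon>"] by auto
  define D :: nat where "D = 2 ^ k"
  define m where "m = D + 2 * (D - 1)"
  have D: "D \<ge> 1" "2 / \<epsilon> < real D" using \<open>2 / \<epsilon> < 2 ^ k\<close> by (auto simp: D_def)
  then have m: "real m = 3 * real D - 2" "m \<ge> D" by (auto simp: m_def of_nat_diff)
  \<comment> \<open>The exponent left to spare: for large \<open>n\<close>, the factor
    \<open>n powr (- \<gamma>)\<close> absorbs \<open>c\<close> and the loss
    \<open>2 ^ (2 * D)\<close> from rounding \<open>L\<close>.\<close>
  define \<gamma> where "\<gamma> = 2 / 3 + \<epsilon> - real (2 * D) / real m"
  have \<gamma>: "\<gamma> > 0"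
  proof -
    have "2 < \<epsilon> * real D" using D assms by (simp add: field_simps)
    also have "\<dots> \<le> \<epsilon> * real m" using m assms by simp
    finally have "real (2 * D) < (2 / 3 + \<epsilon>) * real m"
      using m(1) unfolding distrib_right by linarith
    then show ?thesis using D(1) m(2) by (simp add: \<gamma>_def pos_divide_less_eq)
  qed
  obtain c where c: "c > 0" and config:
    "\<And>L n. L \<ge> 1 \<Longrightarrow> n \<le> L ^ m \<Longrightarrow> \<exists>p l. pl_config n p l \<and>
      (\<forall>i\<in>{1..n}. \<forall>j\<in>{1..n}. i \<noteq> j \<longrightarrow> c / real L ^ (2 * D) \<le> infdist (p i) (l j))"
    using separated_config[of k] unfolding D_def[symmetric] m_def[symmetric] by blast
  have "((\<lambda>n. real n powr (- \<gamma>)) \<longlongrightarrow> 0) sequentially"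
    using \<gamma> by (intro tendsto_neg_powr filterlim_real_sequentially) auto
  then have "\<forall>\<^sub>F n in sequentially. real n powr (- \<gamma>) < c / 2 ^ (2 * D)"
    using c by (intro order_tendstoD) auto
  then obtain n1 where n1: "\<And>n. n \<ge> n1 \<Longrightarrow> real n powr (- \<gamma>) < c / 2 ^ (2 * D)"
    by (auto simp: eventually_sequentially)
  show ?thesis
  proof (intro exI[of _ "max 2 n1"] conjI allI impI)
    fix n assume n: "max 2 n1 \<le> n"
    obtain L where L: "L \<ge> 1" "n \<le> L ^ m" "real L \<le> 2 * real n powr (1 / real m)"
      using ex_power_ge[of m n] D m n by auto
    have "real n powr (- 2 / 3 - \<epsilon>) = real n powr (- \<gamma>) / real n powr (real (2 * D) / real m)"
      by (simp add: \<gamma>_def flip: powr_diff)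
    also have "\<dots> \<le> c / 2 ^ (2 * D) / real n powr (real (2 * D) / real m)"
      using n1[of n] n by (intro divide_right_mono) auto
    also have "\<dots> = c / (2 * real n powr (1 / real m)) ^ (2 * D)"
      using n by (simp add: power_mult_distrib powr_power)
    also have "\<dots> \<le> c / real L ^ (2 * D)"
      using L c n by (intro divide_left_mono power_mono mult_pos_pos) auto
    finally have le: "real n powr (- 2 / 3 - \<epsilon>) \<le> c / real L ^ (2 * D)" .
    obtain p l where pl: "pl_config n p l"
      "\<forall>i\<in>{1..n}. \<forall>j\<in>{1..n}. i \<noteq> j \<longrightarrow> c / real L ^ (2 * D) \<le> infdist (p i) (l j)"
      using config[OF L(1,2)] by blast
    have sep: "real n powr (- 2 / 3 - \<epsilon>) \<le> infdist (p i) (l j)"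
      if "i \<in> {1..n}" "j \<in> {1..n}" "i \<noteq> j" for i j
      using pl(2) that le by (meson order_trans)
    show "\<exists>(p :: nat \<Rightarrow> real^2) (l :: nat \<Rightarrow> (real^2) set). pl_config n p l \<and>
        (\<forall>i\<in>{1..n}. \<forall>j\<in>{1..n}. i \<noteq> j \<longrightarrow> infdist (p i) (l j) \<ge> real n powr (- 2 / 3 - \<epsilon>))"
      using pl(1) sep by blast
    show "real n powr (- 2 / 3 - \<epsilon>) \<le> Delta_PL n"
      using n pl(1) sep by (intro Delta_PL_ge) auto
  qed simp
qed

end
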